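(* Let $N$ be a positive integer, let $B$ be the $N\times N$ real upper bidiagonal matrix with diagonal entries $\sqrt{q_1},\dots,\sqrt{q_N}$ and upper subdiagonal entries $\sqrt{e_1},\dots,\sqrt{e_{N-1}}$, where all $q_i>0$ and $e_i>0$. Let $V=(V_{i,j})$ denote the matrix $(B^{\top}B)^{-1}$. Let $g_i^{(M)}$ ($i=1,\dots,N$, $M=1,2,\dots$) be the quantities defined recursively in the context. Then for all $i=1,\dots,N$, $$g_i^{(2)}=\sum_{j_1=i+1}^{N}V_{i,j_1}V_{j_1,i},$$ $$g_i^{(3)}=\sum_{j_1=i+1}^{N}\sum_{j_2=i+1}^{N}V_{i,j_1}V_{j_1,j_2}V_{j_2,i},$$ $$g_i^{(M)}=\sum_{j_1=i+1}^{N}\cdots\sum_{j_{M-1}=i+1}^{N}V_{i,j_1}V_{j_1,j_2}\cdots V_{j_{M-2},j_{M-1}}V_{j_{M-1},i},\qquad M=4,5,\dots.$$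
   Context: The matrix $B$ has $(i,i)$-entry $\sqrt{q_i}$ ($i=1,\dots,N$), $(i,i+1)$-entry $\sqrt{e_i}$ ($i=1,\dots,N-1$), and all other entries zero. Convention: $\sum_{i=j}^{k}=0$ if $j>k$. Put $\check B_i=1/q_i$ for $i=1,\dots,N$ and $F_i=e_i/q_i$ for $i=1,\dots,N-1$. Let $v_i^{(1)}$ denote the $(i,i)$-entry of $(B^{\top}B)^{-1}$. The quantities $g_i^{(r)}$ for $i=1,\dots,N$ and $r=1,2,\dots$ are defined by: - $g_N^{(r)}=0$ for every positive integer $r$; - $g_i^{(1)}=F_i\,v_{i+1}^{(1)}$ for $i=1,\dots,N-1$; - $g_i^{(r)}=F_i\,g_{i+1}^{(r)}+\check B_{i+1}\,g_i^{(r-1)}+\sum_{k=1}^{r-1}g_{i+1}^{(k)}\,g_i^{(r-k)}$ for $i=1,\dots,N-1$ and $r=2,3,\dots$. *)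

theory Defs
  imports Complex_Main "HOL-Library.FuncSet" "Jordan_Normal_Form.Gauss_Jordan_Elimination"
    "Jordan_Normal_Form.Determinant"
begin

text \<open>The sequences \<open>q\<close>, \<open>e\<close> and all indices \<open>i\<close>, \<open>j\<close> below are 1-based;
  entries of the library's matrices are addressed from 0, whence the shifts.\<close>

definition bidiag :: "nat \<Rightarrow> (nat \<Rightarrow> real) \<Rightarrow> (nat \<Rightarrow> real) \<Rightarrow> real mat" where
  "bidiag N q e = mat N N (\<lambda>(i, j).
     if j = i then sqrt (q (i + 1)) else if j = i + 1 then sqrt (e (i + 1)) else 0)"

text \<open>\<open>mat_inverse\<close> returns \<open>Some\<close> of the inverse for an invertible matrix;
  see \<open>Vmat_inverse\<close> below.\<close>

definition Vmat :: "nat \<Rightarrow> (nat \<Rightarrow> real) \<Rightarrow> (nat \<Rightarrow> real) \<Rightarrow> real mat" where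
  "Vmat N q e = the (mat_inverse (transpose_mat (bidiag N q e) * bidiag N q e))"

definition V :: "nat \<Rightarrow> (nat \<Rightarrow> real) \<Rightarrow> (nat \<Rightarrow> real) \<Rightarrow> nat \<Rightarrow> nat \<Rightarrow> real" where
  "V N q e i j = Vmat N q e $$ (i - 1, j - 1)"

text \<open>\<open>g N q e r i\<close> is $g_i^{(r)}$. Only \<open>1 \<le> i \<le> N\<close> and \<open>r \<ge> 1\<close> are meaningful;
  the value for \<open>r = 0\<close> or \<open>i > N\<close> is a dummy that is never used there.\<close>

function g :: "nat \<Rightarrow> (nat \<Rightarrow> real) \<Rightarrow> (nat \<Rightarrow> real) \<Rightarrow> nat \<Rightarrow> nat \<Rightarrow> real" where
  "g N q e r i =
    (if r = 0 \<or> i \<ge> N then 0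
     else if r = 1 then e i / q i * V N q e (i + 1) (i + 1)
     else e i / q i * g N q e r (i + 1) + 1 / q (i + 1) * g N q e (r - 1) i
          + (\<Sum>k = 1..r - 1. g N q e k (i + 1) * g N q e (r - k) i))"
  by pat_completeness auto
termination
  by (relation "measures [\<lambda>(N, q, e, r, i). r, \<lambda>(N, q, e, r, i). N - i]") auto

declare g.simps [simp del]

lemma Vmat_inverse:
  assumes "\<And>i. i \<in> {1..N} \<Longrightarrow> q i > 0"
  shows "Vmat N q e \<in> carrier_mat N N"
    and "Vmat N q e * (transpose_mat (bidiag N q e) * bidiag N q e) = 1\<^sub>m N"
    and "(transpose_mat (bidiag N q e) * bidiag N q e) * Vmat N q e = 1\<^sub>m N"
proof -
  let ?B = "bidiag N q e" and ?A = "transpose_mat (bidiag N q e) * bidiag N q e"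
  have B: "?B \<in> carrier_mat N N" by (simp add: bidiag_def)
  hence A: "?A \<in> carrier_mat N N" by simp
  have "det ?B = prod_list (diag_mat ?B)"
    by (rule det_upper_triangular[OF _ B]) (auto simp: bidiag_def)
  also have "\<dots> = (\<Prod>i<N. sqrt (q (i + 1)))"
    by (simp add: prod_list_diag_prod bidiag_def atLeast0LessThan)
  also have "\<dots> \<noteq> 0"
  proof -
    have "sqrt (q (i + 1)) \<noteq> 0" if "i < N" for i
      using assms[of "i + 1"] that by simp
    thus ?thesis by (subst prod_zero_iff) auto
  qed
  finally have "det ?B \<noteq> 0" .
  moreover have "det ?A = det (transpose_mat ?B) * det ?B"
    by (rule det_mult[OF _ B]) (use B in simp)
  ultimately have "det ?A \<noteq> 0"
    unfolding det_transpose[OF B] by simp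
  hence "?A \<in> Units (ring_mat TYPE(real) N ())"
    by (rule det_non_zero_imp_unit[OF A])
  with mat_inverse(1)[OF A] obtain C where C: "mat_inverse ?A = Some C"
    by (meson not_None_eq)
  have V: "Vmat N q e = C" unfolding Vmat_def C option.sel ..
  note inv = mat_inverse(2)[OF A C]
  show "Vmat N q e \<in> carrier_mat N N" "Vmat N q e * ?A = 1\<^sub>m N" "?A * Vmat N q e = 1\<^sub>m N"
    unfolding V using inv by blast+
qed

end

theory Submission
  imports Defs
begin

text \<open>
  The sum for $g_i^{(M)}$ is the total weight, with kernel $V$, of the closed walks of length $M$
  at $i$ whose inner vertices all exceed $i$. Since $B V$ is the inverse of $B^\top$, it is lower
  triangular with diagonal $1/\sqrt{q_i}$, which gives $V_{i,j} = -\sqrt{F_i}\, V_{i+1,j}$ for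
  $j > i$ and $V_{i,i} = 1/q_i + F_i V_{i+1,i+1}$. Replacing both end points $i$ by $i+1$ therefore
  only costs a factor $F_i$, and splitting the resulting walks at their last inner visit to $i+1$
  yields exactly the recursion that defines $g_i^{(M)}$.
\<close>

section \<open>Weighted walks with inner vertices in a prescribed set\<close>

text \<open>\<open>n\<close> counts the inner vertices, so the walks have \<open>n + 1\<close> steps.\<close>

fun walk :: "('v \<Rightarrow> 'v \<Rightarrow> 'a::comm_semiring_1) \<Rightarrow> 'v set \<Rightarrow> nat \<Rightarrow> 'v \<Rightarrow> 'v \<Rightarrow> 'a" where
  "walk K S 0 a b = K a b"
| "walk K S (Suc n) a b = (\<Sum>c\<in>S. walk K S n a c * K c b)"

text \<open>Each walk that visits \<open>x\<close> is cut at its last inner visit to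
  \<open>x\<close>: the tail has \<open>m\<close> inner vertices and avoids \<open>x\<close>, while
  the head has the remaining \<open>n - 1 - m\<close> and may return to \<open>x\<close>.\<close>

lemma walk_insert:
  assumes "finite S" "x \<notin> S"
  shows "walk K (insert x S) n a b =
    walk K S n a b + (\<Sum>m<n. walk K S m x b * walk K (insert x S) (n - 1 - m) a x)"
proof (induction n arbitrary: b)
  case 0
  show ?case by simp
next
  case (Suc n)
  let ?w = "walk K (insert x S)"
  \<comment> \<open>The last inner vertex is either \<open>x\<close>, which is the summand
    \<open>m = 0\<close> with tail \<open>K x b\<close>, or it lies in \<open>S\<close> and
    lengthens the tail by one step.\<close>
  have "?w (Suc n) a b = ?w n a x * K x b + (\<Sum>c\<in>S. ?w n a c * K c b)"
    using assms by simp
  also have "(\<Sum>c\<in>S. ?w n a c * K c b) =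
      (\<Sum>c\<in>S. walk K S n a c * K c b)
      + (\<Sum>c\<in>S. \<Sum>m<n. walk K S m x c * K c b * ?w (n - 1 - m) a x)"
    by (simp add: Suc.IH distrib_right sum.distrib sum_distrib_right distrib_left sum_distrib_left mult_ac)
  also have "(\<Sum>c\<in>S. \<Sum>m<n. walk K S m x c * K c b * ?w (n - 1 - m) a x) =
      (\<Sum>m<n. walk K S (Suc m) x b * ?w (n - 1 - m) a x)"
    by (subst sum.swap) (simp add: sum_distrib_right)
  finally show ?case
    by (simp add: sum.lessThan_Suc_shift ac_simps del: sum.lessThan_Suc)
qed

text \<open>Only the first step of a walk sees its source. With at least one inner vertex that step
  ends in \<open>S\<close>, where the hypothesis applies; hence \<open>Suc n\<close>. The next lemma
  is the counterpart for the last step.\<close>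

lemma walk_scale_source:
  assumes "\<And>c. c \<in> S \<Longrightarrow> K a c = s * K a' c"
  shows "walk K S (Suc n) a b = s * walk K S (Suc n) a' b"
proof (induction n arbitrary: b)
  case 0
  show ?case using assms by (simp add: sum_distrib_left mult.assoc)
next
  case (Suc n)
  show ?case
    by (subst (1 2) walk.simps(2), subst Suc.IH) (simp only: sum_distrib_left mult.assoc)
qed

lemma walk_scale_target:
  assumes "\<And>c. c \<in> S \<Longrightarrow> K c b = s * K c b'"
  shows "walk K S (Suc n) a b = s * walk K S (Suc n) a b'"
  using assms by (simp add: sum_distrib_left mult.left_commute)

text \<open>Unfolds the recursion into an \<open>n\<close>-fold sum. As \<open>n\<close> is
  variable, the inner vertices are collected into one tuple, encoded as an extensional function on
  \<open>{1..n}\<close>.\<close>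

lemma walk_eq_sum_PiE:
  assumes "n \<ge> 1"
  shows "walk K S n a b =
    (\<Sum>j \<in> {1..n} \<rightarrow>\<^sub>E S. K a (j 1) * (\<Prod>k = 1..n - 1. K (j k) (j (k + 1))) * K (j n) b)"
  using assms
proof (induction n arbitrary: b rule: nat_induct_at_least)
  case base
  have "(\<Sum>j \<in> {1..1::nat} \<rightarrow>\<^sub>E S. K a (j 1) * K (j 1) b) = (\<Sum>c\<in>S. K a c * K c b)"
    by (rule sum.reindex_bij_witness[where i = "\<lambda>c. \<lambda>i\<in>{1}. c" and j = "\<lambda>j. j 1"])
      (auto simp: PiE_def extensional_def fun_eq_iff)
  then show ?case by simp
next
  case (Suc n)
  let ?T = "\<lambda>n j b. K a (j 1) * (\<Prod>k = 1..n - 1. K (j k) (j (k + 1))) * K (j n) b"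
  \<comment> \<open>\<open>?h\<close> appends the last inner vertex \<open>c\<close> to a tuple of
    length \<open>n\<close>.\<close>
  let ?h = "\<lambda>(c, j). j(Suc n := c)"
  have ins: "{1..Suc n} = insert (Suc n) {1..n}"
    by auto
  have inj: "inj_on ?h (S \<times> ({1..n} \<rightarrow>\<^sub>E S))"
    by (rule inj_combinator) simp
  have step: "?T (Suc n) (j(Suc n := c)) b = ?T n j c * K c b" for j c
  proof -
    have "(\<Prod>k = 1..n. K ((j(Suc n := c)) k) ((j(Suc n := c)) (k + 1)))
        = (\<Prod>k = 1..n - 1. K (j k) (j (k + 1))) * K (j n) c"
    proof -
      have eq: "{1..n} = insert n {1..n - 1}"
        using Suc.hyps by auto
      show ?thesis
        using Suc.hyps unfolding eq
        by (subst prod.insert) (auto simp: mult.commute intro!: prod.cong arg_cong2[where f = "(*)"])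
    qed
    then show ?thesis
      using Suc.hyps by (simp add: mult.assoc)
  qed
  have "(\<Sum>j \<in> {1..Suc n} \<rightarrow>\<^sub>E S. ?T (Suc n) j b)
      = (\<Sum>(c, j) \<in> S \<times> ({1..n} \<rightarrow>\<^sub>E S). ?T (Suc n) (j(Suc n := c)) b)"
    unfolding ins PiE_insert_eq
    by (subst sum.reindex[OF inj]) (simp add: case_prod_unfold)
  also have "\<dots> = (\<Sum>c\<in>S. (\<Sum>j \<in> {1..n} \<rightarrow>\<^sub>E S. ?T n j c) * K c b)"
    unfolding step by (simp add: sum.cartesian_product[symmetric] sum_distrib_right)
  also have "\<dots> = walk K S (Suc n) a b"
    by (simp add: Suc.IH)
  finally show ?case by (rule sym)
qed

section \<open>Entries of the inverse of $B^T B$\<close>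

context
  fixes N :: nat and q e :: "nat \<Rightarrow> real"
  assumes q_pos: "\<And>i. i \<in> {1..N} \<Longrightarrow> q i > 0"
begin

lemma V_sym:
  assumes "i \<in> {1..N}" "j \<in> {1..N}"
  shows "V N q e i j = V N q e j i"
proof -
  let ?B = "bidiag N q e" and ?W = "Vmat N q e"
  let ?A = "transpose_mat ?B * ?B"
  note W = Vmat_inverse[where N = N and q = q and e = e, OF q_pos]
  have B: "?B \<in> carrier_mat N N" by (simp add: bidiag_def)
  have A: "?A \<in> carrier_mat N N" using B by simp
  have At: "transpose_mat ?A = ?A"
    using B by (simp add: transpose_mult[of _ N N])
  have Wt: "transpose_mat ?W \<in> carrier_mat N N" using W(1) by simp
  have "transpose_mat ?W * ?A = transpose_mat (?A * ?W)"
    using transpose_mult[OF A W(1)] At by simp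
  then have "transpose_mat ?W * ?A = 1\<^sub>m N"
    using W(3) by simp
  then have "transpose_mat ?W = transpose_mat ?W * (?A * ?W)"
    using W(3) Wt by simp
  also have "\<dots> = (transpose_mat ?W * ?A) * ?W"
    using Wt A W(1) by (simp add: assoc_mult_mat[of _ N N _ N _ N])
  also have "\<dots> = ?W"
    using \<open>transpose_mat ?W * ?A = 1\<^sub>m N\<close> W(1) by simp
  finally have "transpose_mat ?W $$ (j - 1, i - 1) = ?W $$ (j - 1, i - 1)"
    by simp
  moreover have "i - 1 < N" "j - 1 < N" using assms by auto
  ultimately show ?thesis
    using W(1) by (simp add: V_def)
qed

lemma bidiag_row_sum:
  assumes "a < N"
  shows "(\<Sum>k<N. bidiag N q e $$ (a, k) * f k) =
    sqrt (q (a + 1)) * f a + (if a + 1 < N then sqrt (e (a + 1)) * f (a + 1) else 0)"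
proof -
  have "(\<Sum>k<N. bidiag N q e $$ (a, k) * f k) =
      (\<Sum>k<N. (if k = a then sqrt (q (a + 1)) * f a else 0)
            + (if k = a + 1 then sqrt (e (a + 1)) * f (a + 1) else 0))"
    using assms by (intro sum.cong) (auto simp: bidiag_def)
  then show ?thesis
    using assms by (simp add: sum.distrib)
qed

lemma bidiag_mult_Vmat:
  assumes "a \<le> b" "b < N"
  shows "(bidiag N q e * Vmat N q e) $$ (a, b) = (if a = b then 1 / sqrt (q (a + 1)) else 0)"
proof -
  let ?B = "bidiag N q e" and ?W = "Vmat N q e"
  let ?D = "?B * ?W"
  note W = Vmat_inverse[where N = N and q = q and e = e, OF q_pos]
  have B: "?B \<in> carrier_mat N N" by (simp add: bidiag_def)
  have D: "?D \<in> carrier_mat N N" using B W(1) by simp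
  have "transpose_mat ?B * ?D = 1\<^sub>m N"
    using W(3) B W(1) by (simp add: assoc_mult_mat[of _ N N _ N _ N])
  then have DB: "?D * transpose_mat ?B = 1\<^sub>m N"
    using mat_mult_left_right_inverse[of "transpose_mat ?B" N ?D] B D by simp
  \<comment> \<open>This is the entry \<open>(a, b)\<close> of
    \<open>?D * transpose_mat ?B = 1\<close>; row \<open>b\<close> of \<open>?B\<close> has at most
    two nonzero entries.\<close>
  have rec: "sqrt (q (b + 1)) * ?D $$ (a, b)
      + (if b + 1 < N then sqrt (e (b + 1)) * ?D $$ (a, b + 1) else 0) = (if a = b then 1 else 0)"
    if "a < N" "b < N" for a b
  proof -
    have "(?D * transpose_mat ?B) $$ (a, b) = (\<Sum>k<N. ?B $$ (b, k) * ?D $$ (a, k))"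
      using that B D
      by (auto simp: index_mult_mat(1)[of a ?D b] scalar_prod_def atLeast0LessThan mult.commute
          simp del: index_mult_mat(1) intro!: sum.cong)
    then show ?thesis
      unfolding DB using bidiag_row_sum[OF that(2), of "\<lambda>k. ?D $$ (a, k)"] that by simp
  qed
  have qn: "sqrt (q (b + 1)) \<noteq> 0" if "b < N" for b
    using q_pos[of "b + 1"] that by simp
  \<comment> \<open>Back substitution along row \<open>a\<close>, starting from the last column,
    where the second term of \<open>rec\<close> is absent.\<close>
  have zero: "?D $$ (a, b) = 0" if "a < b" "b < N" for b
    using that
  proof (induction "N - b" arbitrary: b rule: less_induct)
    case less
    have "b + 1 < N \<Longrightarrow> ?D $$ (a, b + 1) = 0"
      using less by simp
    then show ?case
      using rec[of a b] less.prems qn[of b] by (auto split: if_splits)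
  qed
  show ?thesis
  proof (cases "a = b")
    case True
    then show ?thesis
      using rec[of a b] zero[of "b + 1"] qn[of b] assms by (auto simp: field_simps split: if_splits)
  next
    case False
    then show ?thesis using zero[of b] assms by simp
  qed
qed

lemma V_row_recursion:
  assumes "1 \<le> i" "i \<le> j" "j \<le> N"
  shows "sqrt (q i) * V N q e i j + (if i < N then sqrt (e i) * V N q e (i + 1) j else 0)
    = (if i = j then 1 / sqrt (q i) else 0)"
proof -
  let ?B = "bidiag N q e" and ?W = "Vmat N q e"
  have B: "?B \<in> carrier_mat N N" by (simp add: bidiag_def)
  note W = Vmat_inverse(1)[where N = N and q = q and e = e, OF q_pos]
  have lt: "i - 1 < N" "j - 1 < N" using assms by auto
  have "(?B * ?W) $$ (i - 1, j - 1) = (\<Sum>k<N. ?B $$ (i - 1, k) * ?W $$ (k, j - 1))"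
    using lt B W by (simp add: scalar_prod_def atLeast0LessThan)
  then show ?thesis
    using bidiag_row_sum[OF lt(1), of "\<lambda>k. ?W $$ (k, j - 1)"]
      bidiag_mult_Vmat[of "i - 1" "j - 1"] assms
    by (auto simp: V_def split: if_splits)
qed

lemma V_above_diag:
  assumes "1 \<le> i" "i < j" "j \<le> N"
  shows "V N q e i j = - (sqrt (e i) / sqrt (q i)) * V N q e (i + 1) j"
  using V_row_recursion[of i j] q_pos[of i] assms by (simp add: field_simps)

section \<open>Identification of the recursive quantities with walks\<close>

context
  assumes e_nonneg: "\<And>i. i \<in> {1..N - 1} \<Longrightarrow> e i \<ge> 0"
begin

text \<open>Combine row \<open>i\<close> of $B V$ with \<open>V_above_diag\<close> for
  \<open>V_{i+1,i}\<close>, available by symmetry. Writing the second term as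
  \<open>g N q e 1 i\<close> also covers \<open>i = N\<close>, where it is 0.\<close>

lemma V_diag:
  assumes "i \<in> {1..N}"
  shows "V N q e i i = 1 / q i + g N q e 1 i"
proof -
  have q: "q i > 0" using q_pos assms by simp
  have sq: "sqrt (q i) * sqrt (q i) = q i" using q by simp
  have row: "sqrt (q i) * V N q e i i + (if i < N then sqrt (e i) * V N q e (i + 1) i else 0)
      = 1 / sqrt (q i)"
    using V_row_recursion[of i i] assms by simp
  show ?thesis
  proof (cases "i < N")
    case True
    have se: "sqrt (e i) * sqrt (e i) = e i" using e_nonneg[of i] True assms by simp
    have "V N q e (i + 1) i = - (sqrt (e i) / sqrt (q i)) * V N q e (i + 1) (i + 1)"
      using V_above_diag[of i "i + 1"] V_sym[of "i + 1" i] True assms by simp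
    with row True have "sqrt (q i) * V N q e i i =
        1 / sqrt (q i) + sqrt (e i) * sqrt (e i) / sqrt (q i) * V N q e (i + 1) (i + 1)"
      by (simp del: real_sqrt_mult_self)
    then have "sqrt (q i) * (sqrt (q i) * V N q e i i) = 1 + e i * V N q e (i + 1) (i + 1)"
      using q unfolding se by (simp add: field_simps)
    then have "q i * V N q e i i = 1 + e i * V N q e (i + 1) (i + 1)"
      unfolding mult.assoc[symmetric] sq .
    then show ?thesis
      using q True by (subst g.simps) (simp add: field_simps)
  next
    case False
    with row have "sqrt (q i) * (sqrt (q i) * V N q e i i) = 1"
      using q by (simp add: field_simps)
    then have "q i * V N q e i i = 1"
      unfolding mult.assoc[symmetric] sq .
    then show ?thesis
      using q False by (subst g.simps) (simp add: field_simps)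
  qed
qed

text \<open>The first and the last step each contribute \<open>- sqrt (e i) / sqrt (q i)\<close>,
  and the signs cancel. An inner vertex is required: the direct step from \<open>i\<close> to
  \<open>i\<close> has the extra term \<open>1 / q i\<close> of \<open>V_diag\<close>.\<close>

lemma walk_V_shift:
  assumes "1 \<le> i" "i < N"
  shows "walk (V N q e) {i + 1..N} (Suc n) i i =
    e i / q i * walk (V N q e) {i + 1..N} (Suc n) (i + 1) (i + 1)"
proof -
  let ?s = "- (sqrt (e i) / sqrt (q i))"
  have row: "V N q e i c = ?s * V N q e (i + 1) c" if "c \<in> {i + 1..N}" for c
    using V_above_diag[of i c] that assms by simp
  have col: "V N q e c i = ?s * V N q e c (i + 1)" if "c \<in> {i + 1..N}" for c
    using row[OF that] V_sym[of c i] V_sym[of c "i + 1"] that assms by simp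
  have "?s * ?s = e i / q i"
    using q_pos[of i] e_nonneg[of i] assms by (simp add: field_simps)
  then show ?thesis
    using walk_scale_source[of "{i + 1..N}" "V N q e", OF row, of n i]
      walk_scale_target[of "{i + 1..N}" "V N q e", OF col, of n "i + 1"]
    by (simp only: mult.assoc[symmetric])
qed

text \<open>With end points \<open>i + 1\<close> the formula also holds for \<open>n = 0\<close>,
  where it is the definition of $g_i^{(1)}$; with end points \<open>i\<close> it would not. This
  makes it suitable for induction.\<close>

lemma g_eq_shifted_walk:
  assumes "1 \<le> i" "i < N"
  shows "g N q e (Suc n) i = e i / q i * walk (V N q e) {i + 1..N} n (i + 1) (i + 1)"
  using assms
\<comment> \<open>The order is lexicographic, since the recursion calls the same superscript at
  \<open>i + 1\<close> and smaller ones at \<open>i\<close> and \<open>i + 1\<close>.\<close>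
proof (induction "(n, N - i)" arbitrary: n i
    rule: wf_induct_rule[OF wf_lex_prod[OF wf_less_than wf_less_than]])
  case 1
  let ?K = "V N q e" and ?F = "e i / q i"
  let ?S = "{i + 1..N}" and ?S' = "{i + 2..N}"
  note i = 1(2,3)
  have ins: "?S = insert (i + 1) ?S'"
    using i by auto
  show ?case
  proof (cases n)
    case 0
    then show ?thesis using i by (subst g.simps) simp
  next
    case n: (Suc n')
    have low: "g N q e (Suc m) i = ?F * walk ?K ?S m (i + 1) (i + 1)" if "m < n" for m
      using 1(1)[of m i] i that by simp
    \<comment> \<open>For \<open>Suc m = n\<close> the induction hypothesis applies because
      \<open>i\<close> grows. If \<open>i + 1 = N\<close>, then \<open>?S'\<close> is empty and both
      sides are 0.\<close>
    have up: "walk ?K ?S' (Suc m) (i + 1) (i + 1) = g N q e (Suc (Suc m)) (i + 1)" if "m < n" for m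
    proof (cases "i + 1 < N")
      case True
      then show ?thesis
        using 1(1)[of "Suc m" "i + 1"] walk_V_shift[of "i + 1" m] i that
        by (cases "Suc m < n") auto
    next
      case False
      then show ?thesis using i by (subst g.simps) simp
    qed
    have "?F * walk ?K ?S n (i + 1) (i + 1) =
        ?F * walk ?K ?S' n (i + 1) (i + 1)
        + (\<Sum>m<n. walk ?K ?S' m (i + 1) (i + 1) * (?F * walk ?K ?S (n - 1 - m) (i + 1) (i + 1)))"
      unfolding ins
      by (subst walk_insert) (simp_all add: distrib_left sum_distrib_left mult.left_commute)
    also have "walk ?K ?S' n (i + 1) (i + 1) = g N q e (Suc n) (i + 1)"
      using up[of n'] n by simp
    also have "(\<Sum>m<n. walk ?K ?S' m (i + 1) (i + 1)
          * (?F * walk ?K ?S (n - 1 - m) (i + 1) (i + 1)))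
        = (\<Sum>m<n. walk ?K ?S' m (i + 1) (i + 1) * g N q e (n - m) i)"
    proof (rule sum.cong)
      fix m assume "m \<in> {..<n}"
      then have "Suc (n - 1 - m) = n - m" "n - 1 - m < n" by auto
      then show "walk ?K ?S' m (i + 1) (i + 1) * (?F * walk ?K ?S (n - 1 - m) (i + 1) (i + 1))
          = walk ?K ?S' m (i + 1) (i + 1) * g N q e (n - m) i"
        using low[of "n - 1 - m"] by simp
    qed simp
    also have "\<dots> = ?K (i + 1) (i + 1) * g N q e n i
        + (\<Sum>m<n'. g N q e (Suc (Suc m)) (i + 1) * g N q e (n' - m) i)"
      unfolding n sum.lessThan_Suc_shift using up n by simp
    \<comment> \<open>The tail with \<open>m = 0\<close> weighs \<open>V_{i+1,i+1}\<close>, which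
      \<open>V_diag\<close> splits into \<open>1 / q (i + 1)\<close> and $g_{i+1}^{(1)}$. The latter
      is the summand \<open>k = 1\<close> of the convolution.\<close>
    also have "\<dots> = 1 / q (i + 1) * g N q e n i
        + (\<Sum>m<n. g N q e (Suc m) (i + 1) * g N q e (n - m) i)"
      unfolding n sum.lessThan_Suc_shift using V_diag[of "i + 1"] i by (simp add: distrib_right)
    also have "(\<Sum>m<n. g N q e (Suc m) (i + 1) * g N q e (n - m) i)
        = (\<Sum>k = 1..n. g N q e k (i + 1) * g N q e (Suc n - k) i)"
      by (rule sum.reindex_bij_witness[where i = "\<lambda>k. k - 1" and j = Suc]) auto
    finally show ?thesis
      using i n by (subst g.simps) simp
  qed
qed

text \<open>Moving the end points back to \<open>i\<close> absorbs the factor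
  \<open>e i / q i\<close>. For \<open>i = N\<close> no vertex exceeds \<open>i\<close> and both
  sides vanish.\<close>

lemma g_eq_walk:
  assumes "i \<in> {1..N}"
  shows "g N q e (Suc (Suc n)) i = walk (V N q e) {i + 1..N} (Suc n) i i"
proof (cases "i < N")
  case True
  then show ?thesis
    using g_eq_shifted_walk[of i "Suc n"] walk_V_shift[of i n] assms by simp
next
  case False
  then show ?thesis by (subst g.simps) simp
qed

end

end

theorem theorem18:
  fixes N :: nat and q e :: "nat \<Rightarrow> real"
  assumes "N \<ge> 1"
    and "\<And>i. i \<in> {1..N} \<Longrightarrow> q i > 0"
    and "\<And>i. i \<in> {1..N - 1} \<Longrightarrow> e i > 0"
  shows "\<forall>i\<in>{1..N}.
      g N q e 2 i = (\<Sum>j1 = i + 1..N. V N q e i j1 * V N q e j1 i)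
    \<and> g N q e 3 i = (\<Sum>j1 = i + 1..N. \<Sum>j2 = i + 1..N.
                       V N q e i j1 * V N q e j1 j2 * V N q e j2 i)
    \<and> (\<forall>M\<ge>4. g N q e M i =
         (\<Sum>j \<in> {1..M - 1} \<rightarrow>\<^sub>E {i + 1..N}.
            V N q e i (j 1) * (\<Prod>k = 1..M - 2. V N q e (j k) (j (k + 1))) * V N q e (j (M - 1)) i))"
proof (intro ballI conjI allI impI)
  fix i assume i: "i \<in> {1..N}"
  have g_walk: "g N q e (Suc (Suc n)) i = walk (V N q e) {i + 1..N} (Suc n) i i" for n
    using g_eq_walk[of N q e i n] assms(2,3) i by (auto intro: less_imp_le)
  show "g N q e 2 i = (\<Sum>j1 = i + 1..N. V N q e i j1 * V N q e j1 i)"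
    using g_walk[of 0] by (simp add: numeral_2_eq_2)
  show "g N q e 3 i = (\<Sum>j1 = i + 1..N. \<Sum>j2 = i + 1..N.
      V N q e i j1 * V N q e j1 j2 * V N q e j2 i)"
    \<comment> \<open>\<open>walk\<close> has the last inner vertex in its outermost sum, so the two
      sums must be exchanged.\<close>
    using g_walk[of 1]
    by (subst sum.swap) (simp add: numeral_3_eq_3 sum_distrib_right)
  fix M :: nat assume "M \<ge> 4"
  then obtain n where M: "M = Suc (Suc n)"
    by (metis add_2_eq_Suc le_Suc_ex numeral_Bit0 add.assoc)
  show "g N q e M i =
      (\<Sum>j \<in> {1..M - 1} \<rightarrow>\<^sub>E {i + 1..N}.
         V N q e i (j 1) * (\<Prod>k = 1..M - 2. V N q e (j k) (j (k + 1))) * V N q e (j (M - 1)) i)"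
    \<comment> \<open>Here \<open>M - 1 = Suc n\<close> is the number of inner vertices.\<close>
    unfolding M g_walk by (subst walk_eq_sum_PiE) simp_all
qed

end
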